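(* Let $p>2$ be a prime and let $d>1$ be a divisor of $p-1$. Let $n\ge 1$, let $H\le F_n$ and let $\mathrm{Cl}(H)$ denote the $(\mathbf{Ab}(p)*\mathbf{Ab}(d))$-closure of $H$ in $F_n$, i.e. its closure in the pro-$(\mathbf{Ab}(p)*\mathbf{Ab}(d))$ topology on $F_n$. Then: (i) $\mathrm{Cl}(H)=HL_{n,p,d}$; (ii) $\mathrm{Cl}(H)$ has finite index in $F_n$; (iii) $\mathrm{Cl}(H)$ is finitely generated.
   Context: $F_n$ is the free group of rank $n$. A pseudovariety is a class of finite groups closed under taking subgroups, homomorphic images and finitary direct products. $\mathbf{Ab}(m)$ is the pseudovariety of finite abelian groups of exponent dividing $m$. For pseudovarieties $\mathbf{V},\mathbf{W}$, $\mathbf{V}*\mathbf{W}$ is the pseudovariety of all finite groups $G$ having a normal subgroup $N\in\mathbf{V}$ with $G/N\in\mathbf{W}$. For a pseudovariety $\mathbf{V}$, the pro-$\mathbf{V}$ topology on a group $G$ is the group topology in which the normal subgroups $K$ with $G/K\in\mathbf{V}$ form a basis of neighbourhoods of the identity. For a normal subgroup $N$ of a group, $\mathrm{pow}_k(N)$ is the subgroup generated by all $u^k$ with $u\in N$. Set $K_{n,d}=[F_n,F_n]\,\mathrm{pow}_d(F_n)$ and $L_{n,p,d}=[K_{n,d},K_{n,d}]\,\mathrm{pow}_p(K_{n,d})$. *)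

theory Defs
  imports "HOL-Algebra.Generated_Groups" "HOL-Computational_Algebra.Primes" "HOL-Analysis.Abstract_Topology"
begin

text \<open>The free group on a set \<open>X\<close> as the group of reduced words. A letter \<open>(x, True)\<close> is the
  generator \<open>x\<close>, a letter \<open>(x, False)\<close> is its formal inverse. The product is concatenation
  followed by free reduction.\<close>

definition inv_letter :: "'x \<times> bool \<Rightarrow> 'x \<times> bool" where
  "inv_letter a = (fst a, \<not> snd a)"

fun reduced :: "('x \<times> bool) list \<Rightarrow> bool" where
  "reduced [] \<longleftrightarrow> True"
| "reduced [a] \<longleftrightarrow> True"
| "reduced (a # b # w) \<longleftrightarrow> b \<noteq> inv_letter a \<and> reduced (b # w)"

fun cons_red :: "'x \<times> bool \<Rightarrow> ('x \<times> bool) list \<Rightarrow> ('x \<times> bool) list" where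
  "cons_red a [] = [a]"
| "cons_red a (b # w) = (if b = inv_letter a then w else a # b # w)"

definition free_group :: "'x set \<Rightarrow> ('x \<times> bool) list monoid" where
  "free_group X =
     \<lparr>carrier = {w. reduced w \<and> fst ` set w \<subseteq> X},
      monoid.mult = (\<lambda>u v. foldr cons_red u v),
      one = []\<rparr>"

definition F :: "nat \<Rightarrow> (nat \<times> bool) list monoid" where
  "F n = free_group {..<n}"

lemma inv_letter_inv [simp]: "inv_letter (inv_letter a) = a"
  by (simp add: inv_letter_def)

lemma fst_inv_letter [simp]: "fst (inv_letter a) = fst a"
  by (simp add: inv_letter_def)

lemma reduced_ConsD: "reduced (a # w) \<Longrightarrow> reduced w"
  by (cases w) auto

lemma reduced_cons_red: "reduced w \<Longrightarrow> reduced (cons_red a w)"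
  by (cases w) (auto dest: reduced_ConsD)

lemma reduced_foldr: "reduced w \<Longrightarrow> reduced (foldr cons_red u w)"
  by (induction u) (auto intro: reduced_cons_red)

lemma set_cons_red: "set (cons_red a w) \<subseteq> insert a (set w)"
  by (cases w) auto

lemma set_foldr_cons_red: "set (foldr cons_red u w) \<subseteq> set u \<union> set w"
proof (induction u)
  case (Cons a u)
  then show ?case using set_cons_red[of a "foldr cons_red u w"] by auto
qed simp

lemma cons_red_reduced: "reduced (a # w) \<Longrightarrow> cons_red a w = a # w"
  by (cases w) auto

lemma cons_red_cancel: "reduced w \<Longrightarrow> cons_red a (cons_red (inv_letter a) w) = w"
  by (cases w) (auto simp: cons_red_reduced)

lemma foldr_cons_red_Nil: "reduced u \<Longrightarrow> foldr cons_red u [] = u"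
proof (induction u)
  case (Cons a u)
  then show ?case using reduced_ConsD[OF Cons.prems] by (simp add: cons_red_reduced)
qed simp

lemma foldr_cons_red_cons_red:
  assumes "reduced w"
  shows "foldr cons_red (cons_red a v) w = cons_red a (foldr cons_red v w)"
  using assms cons_red_cancel[OF reduced_foldr[OF assms]] by (cases v) auto

lemma foldr_cons_red_assoc:
  "reduced w \<Longrightarrow> foldr cons_red (foldr cons_red u v) w = foldr cons_red u (foldr cons_red v w)"
  by (induction u) (auto simp: foldr_cons_red_cons_red)

lemma foldr_cons_red_inverse:
  "reduced w \<Longrightarrow> foldr cons_red (rev (map inv_letter u)) (foldr cons_red u w) = w"
proof (induction u)
  case (Cons a u)
  then show ?case
    using cons_red_cancel[of "foldr cons_red u w" "inv_letter a"] reduced_foldr[OF Cons.prems]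
    by simp
qed simp

lemma group_free_group: "group (free_group X)"
proof (rule groupI)
  fix u v assume "u \<in> carrier (free_group X)" "v \<in> carrier (free_group X)"
  then show "u \<otimes>\<^bsub>free_group X\<^esub> v \<in> carrier (free_group X)"
    using set_foldr_cons_red[of u v] by (fastforce simp: free_group_def reduced_foldr)
next
  fix u assume u: "u \<in> carrier (free_group X)"
  define v where "v = foldr cons_red (rev (map inv_letter u)) []"
  have "v \<in> carrier (free_group X)"
    using u set_foldr_cons_red[of "rev (map inv_letter u)" "[]"]
    by (fastforce simp: v_def free_group_def reduced_foldr)
  moreover have "v \<otimes>\<^bsub>free_group X\<^esub> u = \<one>\<^bsub>free_group X\<^esub>"
    using u foldr_cons_red_assoc[of u "rev (map inv_letter u)" "[]"]
      foldr_cons_red_inverse[of "[]" u]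
    by (simp add: v_def free_group_def foldr_cons_red_Nil)
  ultimately show "\<exists>v\<in>carrier (free_group X). v \<otimes>\<^bsub>free_group X\<^esub> u = \<one>\<^bsub>free_group X\<^esub>" ..
qed (auto simp: free_group_def foldr_cons_red_assoc)

definition letter_val :: "('a, 'b) monoid_scheme \<Rightarrow> ('x \<Rightarrow> 'a) \<Rightarrow> 'x \<times> bool \<Rightarrow> 'a" where
  "letter_val G f a = (if snd a then f (fst a) else inv\<^bsub>G\<^esub> f (fst a))"

definition word_val :: "('a, 'b) monoid_scheme \<Rightarrow> ('x \<Rightarrow> 'a) \<Rightarrow> ('x \<times> bool) list \<Rightarrow> 'a" where
  "word_val G f w = foldr (\<lambda>a. monoid.mult G (letter_val G f a)) w \<one>\<^bsub>G\<^esub>"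

lemma free_group_universal:
  fixes G (structure)
  assumes "group G" and f: "f \<in> X \<rightarrow> carrier G"
  shows "word_val G f \<in> hom (free_group X) G"
    and "\<forall>x\<in>X. word_val G f [(x, True)] = f x"
    and "\<And>h. h \<in> hom (free_group X) G \<Longrightarrow> (\<forall>x\<in>X. h [(x, True)] = f x) \<Longrightarrow>
           \<forall>w\<in>carrier (free_group X). h w = word_val G f w"
proof -
  interpret group G by fact
  have lv: "letter_val G f a \<in> carrier G" if "fst a \<in> X" for a
    using that f by (auto simp: letter_val_def)
  have wv: "word_val G f w \<in> carrier G" if "fst ` set w \<subseteq> X" for w
    using that by (induction w) (auto simp: word_val_def lv)
  have lvi: "letter_val G f (inv_letter a) = inv (letter_val G f a)" if "fst a \<in> X" for a
    using that f by (auto simp: letter_val_def inv_letter_def Pi_iff)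
  have cr: "word_val G f (cons_red a w) = letter_val G f a \<otimes> word_val G f w"
    if "fst a \<in> X" "fst ` set w \<subseteq> X" for a w
  proof (cases w)
    case Nil then show ?thesis by (simp add: word_val_def)
  next
    case (Cons b v)
    have "word_val G f v = letter_val G f a \<otimes> (inv (letter_val G f a) \<otimes> word_val G f v)"
      using that Cons lv wv[of v] by (simp add: m_assoc[symmetric])
    then show ?thesis
      using Cons that lvi[of a] by (simp add: word_val_def)
  qed
  have fo: "word_val G f (foldr cons_red u v) = word_val G f u \<otimes> word_val G f v"
    if "fst ` set u \<subseteq> X" "fst ` set v \<subseteq> X" for u v
    using that(1)
  proof (induction u)
    case Nil
    then show ?case using wv[OF that(2)] by (simp add: word_val_def)
  next
    case (Cons a u)
    have "fst ` set (foldr cons_red u v) \<subseteq> X"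
      using set_foldr_cons_red[of u v] Cons.prems that(2) by fastforce
    then have "word_val G f (foldr cons_red (a # u) v)
        = letter_val G f a \<otimes> (word_val G f u \<otimes> word_val G f v)"
      using Cons cr[of a] by simp
    also have "\<dots> = (letter_val G f a \<otimes> word_val G f u) \<otimes> word_val G f v"
      using Cons.prems wv[of u] wv[OF that(2)] lv[of a] by (simp add: m_assoc)
    also have "letter_val G f a \<otimes> word_val G f u = word_val G f (a # u)"
      by (simp add: word_val_def)
    finally show ?case .
  qed
  show "word_val G f \<in> hom (free_group X) G"
    by (rule homI) (auto simp: free_group_def wv fo)
  show "\<forall>x\<in>X. word_val G f [(x, True)] = f x"
    using f by (auto simp: word_val_def letter_val_def Pi_iff)
  fix h assume h: "h \<in> hom (free_group X) G" and hx: "\<forall>x\<in>X. h [(x, True)] = f x"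
  interpret FG: group "free_group X" by (rule group_free_group)
  have hl: "h [a] = letter_val G f a" if "fst a \<in> X" for a
  proof (cases a)
    case (Pair x s)
    have c: "[(x, s)] \<in> carrier (free_group X)" for s
      using that Pair by (simp add: free_group_def)
    have "[(x, False)] \<otimes>\<^bsub>free_group X\<^esub> [(x, True)] = \<one>\<^bsub>free_group X\<^esub>"
      by (simp add: free_group_def inv_letter_def)
    then have "h [(x, False)] \<otimes> h [(x, True)] = \<one>"
      using h c hom_mult[OF h] hom_one[OF h FG.is_group is_group] by metis
    then have "h [(x, False)] = inv (h [(x, True)])"
      using c h by (metis hom_in_carrier inv_equality)
    then show ?thesis
      using Pair that hx by (cases s) (auto simp: letter_val_def)
  qed
  show "\<forall>w\<in>carrier (free_group X). h w = word_val G f w"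
  proof
    fix w assume "w \<in> carrier (free_group X)"
    then show "h w = word_val G f w"
    proof (induction w)
      case Nil
      have "\<one>\<^bsub>free_group X\<^esub> = []" by (simp add: free_group_def)
      then show ?case
        using hom_one[OF h FG.is_group is_group] by (simp add: word_val_def)
    next
      case (Cons a w)
      have a: "[a] \<in> carrier (free_group X)" "fst a \<in> X" and w: "w \<in> carrier (free_group X)"
        using Cons.prems by (auto simp: free_group_def dest: reduced_ConsD)
      have "a # w = [a] \<otimes>\<^bsub>free_group X\<^esub> w"
        using Cons.prems by (simp add: free_group_def cons_red_reduced)
      then have "h (a # w) = letter_val G f a \<otimes> h w"
        using hom_mult[OF h a(1) w] hl[OF a(2)] by simp
      then show ?case using Cons.IH[OF w] by (simp add: word_val_def)
    qed
  qed
qed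

text \<open>A class of finite groups is a predicate on groups. In \<open>pv_prod V W\<close> the predicate \<open>V\<close> is
  applied to a subgroup and \<open>W\<close> to a quotient of a group over \<open>'a\<close>, hence the two types.\<close>

definition Ab :: "nat \<Rightarrow> 'a monoid \<Rightarrow> bool" where
  "Ab m G \<longleftrightarrow> comm_group G \<and> finite (carrier G) \<and> (\<forall>x\<in>carrier G. x [^]\<^bsub>G\<^esub> m = \<one>\<^bsub>G\<^esub>)"

definition pv_prod ::
    "('a monoid \<Rightarrow> bool) \<Rightarrow> ('a set monoid \<Rightarrow> bool) \<Rightarrow> 'a monoid \<Rightarrow> bool" where
  "pv_prod V W G \<longleftrightarrow>
     group G \<and> finite (carrier G) \<and> (\<exists>N. N \<lhd> G \<and> V (G\<lparr>carrier := N\<rparr>) \<and> W (G Mod N))"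

text \<open>The topology generated by all cosets \<open>xK\<close> with \<open>K\<close> normal and \<open>G/K\<close> in \<open>V\<close>. For a
  pseudovariety \<open>V\<close> these \<open>K\<close> are closed under finite intersections, and they then form a basis
  of neighbourhoods of the identity: see \<open>openin_pro_topology_iff\<close> below.\<close>

definition pro_topology :: "('a, 'b) monoid_scheme \<Rightarrow> ('a set monoid \<Rightarrow> bool) \<Rightarrow> 'a topology" where
  "pro_topology G V =
     topology_generated_by {x <#\<^bsub>G\<^esub> K | x K. x \<in> carrier G \<and> K \<lhd> G \<and> V (G Mod K)}"

lemma openin_pro_topology_iff:
  fixes G (structure)
  assumes "group G"
    and inter: "\<And>K L. K \<lhd> G \<Longrightarrow> L \<lhd> G \<Longrightarrow> V (G Mod K) \<Longrightarrow> V (G Mod L) \<Longrightarrow> V (G Mod (K \<inter> L))"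
  shows "openin (pro_topology G V) U \<longleftrightarrow>
    U \<subseteq> carrier G \<and> (\<forall>x\<in>U. \<exists>K. K \<lhd> G \<and> V (G Mod K) \<and> x <#\<^bsub>G\<^esub> K \<subseteq> U)"
proof -
  interpret group G by fact
  let ?B = "{x <#\<^bsub>G\<^esub> K | x K. x \<in> carrier G \<and> K \<lhd> G \<and> V (G Mod K)}"
  have sub: "subgroup K G" if "K \<lhd> G" for K
    using that by (simp add: normal_imp_subgroup)
  have self: "x \<in> x <#\<^bsub>G\<^esub> K" if "x \<in> carrier G" "K \<lhd> G" for x K
    using subgroup.one_closed[OF sub[OF that(2)]] that(1) by (force simp: l_coset_def)
  have "U \<subseteq> carrier G \<and> (\<forall>x\<in>U. \<exists>K. K \<lhd> G \<and> V (G Mod K) \<and> x <#\<^bsub>G\<^esub> K \<subseteq> U)"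
    if "generate_topology_on ?B U"
    using that
  proof induction
    case Empty
    then show ?case by simp
  next
    case (Int a b)
    have "\<exists>K. K \<lhd> G \<and> V (G Mod K) \<and> x <#\<^bsub>G\<^esub> K \<subseteq> a \<inter> b" if x: "x \<in> a \<inter> b" for x
    proof -
      obtain K L where K: "K \<lhd> G" "V (G Mod K)" "x <#\<^bsub>G\<^esub> K \<subseteq> a"
        and L: "L \<lhd> G" "V (G Mod L)" "x <#\<^bsub>G\<^esub> L \<subseteq> b"
        using Int.IH x by blast
      have "K \<inter> L \<lhd> G" using K L normal_subgroup_intersect by blast
      moreover have "x <#\<^bsub>G\<^esub> (K \<inter> L) \<subseteq> a \<inter> b" using K(3) L(3) by (auto simp: l_coset_def)
      ultimately show ?thesis using inter K L by blast
    qed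
    then show ?case using Int.IH by blast
  next
    case (UN \<K>)
    then show ?case by (meson Sup_le_iff UnionE Union_upper subset_trans)
  next
    case (Basis s)
    then obtain y K where s: "s = y <#\<^bsub>G\<^esub> K" "y \<in> carrier G" "K \<lhd> G" "V (G Mod K)" by blast
    have "x <#\<^bsub>G\<^esub> K = s" if "x \<in> s" for x
      using l_repr_independence[OF _ s(2) sub[OF s(3)]] that s(1) by simp
    then show ?case
      using s l_coset_subset_G[OF subgroup.subset[OF sub[OF s(3)]] s(2)] by blast
  qed
  moreover have "generate_topology_on ?B U"
    if U: "U \<subseteq> carrier G" "\<forall>x\<in>U. \<exists>K. K \<lhd> G \<and> V (G Mod K) \<and> x <#\<^bsub>G\<^esub> K \<subseteq> U"
  proof -
    have "U = \<Union>{s \<in> ?B. s \<subseteq> U}"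
    proof (intro equalityI subsetI)
      fix x assume x: "x \<in> U"
      then obtain K where "K \<lhd> G" "V (G Mod K)" "x <#\<^bsub>G\<^esub> K \<subseteq> U" using U(2) by blast
      moreover from this x U(1) have "x \<in> x <#\<^bsub>G\<^esub> K" by (auto intro: self)
      ultimately show "x \<in> \<Union>{s \<in> ?B. s \<subseteq> U}" using x U(1) by blast
    qed auto
    moreover have "generate_topology_on ?B (\<Union>{s \<in> ?B. s \<subseteq> U})"
      by (rule generate_topology_on.UN) (auto intro!: generate_topology_on.Basis)
    ultimately show ?thesis by simp
  qed
  ultimately show ?thesis
    unfolding pro_topology_def openin_topology_generated_by_iff by blast
qed

definition pow_subgroup :: "('a, 'b) monoid_scheme \<Rightarrow> nat \<Rightarrow> 'a set \<Rightarrow> 'a set" where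
  "pow_subgroup G k N = generate G {u [^]\<^bsub>G\<^esub> k | u. u \<in> N}"

definition K_sub :: "nat \<Rightarrow> nat \<Rightarrow> (nat \<times> bool) list set" where
  "K_sub n d = derived (F n) (carrier (F n)) <#>\<^bsub>F n\<^esub> pow_subgroup (F n) d (carrier (F n))"

definition L_sub :: "nat \<Rightarrow> nat \<Rightarrow> nat \<Rightarrow> (nat \<times> bool) list set" where
  "L_sub n p d = derived (F n) (K_sub n d) <#>\<^bsub>F n\<^esub> pow_subgroup (F n) p (K_sub n d)"

definition finite_index :: "'a set \<Rightarrow> ('a, 'b) monoid_scheme \<Rightarrow> bool" where
  "finite_index H G \<longleftrightarrow> subgroup H G \<and> finite (rcosets\<^bsub>G\<^esub> H)"

definition finitely_generated :: "'a set \<Rightarrow> ('a, 'b) monoid_scheme \<Rightarrow> bool" where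
  "finitely_generated H G \<longleftrightarrow> (\<exists>S. finite S \<and> S \<subseteq> carrier G \<and> H = generate G S)"

definition Cl :: "nat \<Rightarrow> nat \<Rightarrow> nat \<Rightarrow> (nat \<times> bool) list set \<Rightarrow> (nat \<times> bool) list set" where
  "Cl n p d H = pro_topology (F n) (pv_prod (Ab p) (Ab d)) closure_of H"

end

theory Submission
  imports Defs "HOL-Algebra.SndIsomorphismGrp"
begin

text \<open>
  The group \<open>L = L_sub n p d\<close> is the smallest open normal subgroup of \<open>F n\<close>, and everything
  follows from that.

  For a subgroup \<open>A\<close> of a group let \<open>A(m) = [A, A] pow\<^sub>m(A)\<close> (this is \<open>ab_verbal\<close> below). It is
  trivial exactly if \<open>A\<close> is abelian of exponent dividing \<open>m\<close>, it is monotone in \<open>A\<close>, it is normal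
  when \<open>A\<close> is, and homomorphisms carry \<open>A(m)\<close> onto \<open>f(A)(m)\<close>. A finite group \<open>Q\<close> therefore lies in
  \<open>Ab(p) * Ab(d)\<close> if and only if \<open>Q(d)(p)\<close> is trivial: if \<open>N\<close> witnesses membership, then
  \<open>Q(d) \<subseteq> N\<close>, hence \<open>Q(d)(p) \<subseteq> N(p) = 1\<close>; conversely \<open>Q(d)\<close> is itself a witness. Transported along
  a quotient map, this says that \<open>G/M\<close> lies in the product exactly if it is finite and
  \<open>G(d)(p) \<subseteq> M\<close> (\<open>pv_prod_Ab_Mod_iff\<close>); for \<open>G = F n\<close> the subgroup \<open>G(d)(p)\<close> is \<open>L\<close>.

  It remains to see that \<open>L = K(p)\<close> has finite index, where \<open>K = K_sub n d = G(d)\<close>. The quotient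
  \<open>F n / K\<close> is finitely generated, abelian and of bounded exponent, so it is finite. By Schreier's lemma
  (\<open>finitely_generated_finite_index\<close>) \<open>K\<close> is again finitely generated, so \<open>K / L\<close> is finite by the
  same argument.

  Thus \<open>L\<close> is open and every open set is a union of cosets of \<open>L\<close>, which makes \<open>H L\<close> the closure of
  \<open>H\<close>. It contains \<open>L\<close>, so its index is finite, and Schreier's lemma gives finite generation.
\<close>

section \<open>Finitely generated groups\<close>

text \<open>Schreier's lemma, without a Schreier transversal. Let \<open>T\<close> be a finite set that contains \<open>1\<close>
  and meets every coset of \<open>H\<close>. The subgroup \<open>Q\<close> generated by all \<open>t s t'\<^sup>-\<^sup>1\<close> that lie in \<open>H\<close>, with
  \<open>t, t' \<in> T\<close> and \<open>s\<close> a generator or the inverse of one, satisfies \<open>Q T s \<subseteq> Q T\<close>, hence \<open>Q T = G\<close>.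
  If \<open>Q\<close> also contains \<open>H \<inter> T\<close>, then every \<open>h = q t \<in> H\<close> has \<open>t \<in> H \<inter> T \<subseteq> Q\<close>, so \<open>H = Q\<close>.\<close>

lemma finitely_generated_finite_index:
  fixes G (structure)
  assumes "group G" "finitely_generated (carrier G) G" "subgroup H G" "finite (rcosets H)"
  shows "finitely_generated H G"
proof -
  interpret group G by fact
  interpret H: subgroup H G by fact
  obtain S where S: "finite S" "S \<subseteq> carrier G" "carrier G = generate G S"
    using assms(2) unfolding finitely_generated_def by blast
  define T where "T = insert \<one> ((\<lambda>C. SOME x. x \<in> C) ` (rcosets H))"
  define Y where "Y = H \<inter> (T \<union> (\<lambda>(t, s, t'). t \<otimes> s \<otimes> inv t') ` (T \<times> (S \<union> m_inv G ` S) \<times> T))"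
  define Q where "Q = generate G Y"
  have some: "(SOME x. x \<in> C) \<in> C" if "C \<in> rcosets H" for C
    using H.rcosets_non_empty[OF that] some_in_eq by blast
  have T: "T \<subseteq> carrier G"
    using some H.rcosets_carrier[OF is_group] by (auto simp: T_def)
  have rep: "\<exists>t\<in>T. g \<otimes> inv t \<in> H" if g: "g \<in> carrier G" for g
  proof -
    have C: "H #> g \<in> rcosets H" using g H.subset by (rule rcosetsI[rotated])
    define t where "t = (SOME x. x \<in> H #> g)"
    have t: "t \<in> H #> g" "t \<in> T" using some[OF C] C by (auto simp: t_def T_def)
    have "H #> g = H #> t" using repr_independence[OF t(1) g assms(3)] .
    then have "g \<in> H #> t" using rcos_self[OF g assms(3)] by simp
    then show ?thesis using H.rcos_module_imp[OF is_group] t(2) T by blast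
  qed
  have Y: "finite Y" "Y \<subseteq> H"
    using S(1) assms(4) by (auto simp: Y_def T_def)
  interpret Q: subgroup Q G
    unfolding Q_def using Y(2) H.subset by (intro generate_is_subgroup) blast
  have QH: "Q \<subseteq> H"
    unfolding Q_def by (rule generate_subgroup_incl[OF Y(2) assms(3)])
  \<comment> \<open>\<open>q t a = q (t a t'\<^sup>-\<^sup>1) t'\<close>, where \<open>t'\<close> represents the coset of \<open>t a\<close>.\<close>
  have step: "x \<otimes> a \<in> Q <#> T" if x: "x \<in> Q <#> T" and a: "a \<in> S \<union> m_inv G ` S" for x a
  proof -
    obtain q t where qt: "q \<in> Q" "t \<in> T" "x = q \<otimes> t" using x by (auto simp: set_mult_def)
    have ac: "a \<in> carrier G" using a S(2) by auto
    have tc: "t \<in> carrier G" using qt T by auto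
    obtain t' where t': "t' \<in> T" "t \<otimes> a \<otimes> inv t' \<in> H" using rep[of "t \<otimes> a"] ac tc by auto
    have t'c: "t' \<in> carrier G" using t' T by auto
    have "t \<otimes> a \<otimes> inv t' \<in> Y" unfolding Y_def using t' qt(2) a by force
    then have "t \<otimes> a \<otimes> inv t' \<in> Q" unfolding Q_def by (rule generate.incl)
    then have "q \<otimes> (t \<otimes> a \<otimes> inv t') \<in> Q" using qt(1) by simp
    moreover have "x \<otimes> a = q \<otimes> (t \<otimes> a \<otimes> inv t') \<otimes> t'"
      using qt ac tc t'c by (simp add: m_assoc Q.mem_carrier)
    ultimately show ?thesis using t'(1) by (auto simp: set_mult_def)
  qed
  have QT: "Q <#> T \<subseteq> carrier G" using Q.subset T by (rule set_mult_closed)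
  have absorb: "x \<otimes> g \<in> Q <#> T" if "g \<in> generate G S" "x \<in> Q <#> T" for x g
    using that
  proof (induction arbitrary: x)
    case one
    then show ?case using QT by auto
  next
    case (incl h)
    then show ?case using step by blast
  next
    case (inv h)
    then show ?case using step by blast
  next
    case (eng g h)
    then have "g \<in> carrier G" "h \<in> carrier G" using S(3) by auto
    then have "x \<otimes> (g \<otimes> h) = x \<otimes> g \<otimes> h" using eng.prems QT by (auto simp: m_assoc)
    then show ?case using eng.IH eng.prems by auto
  qed
  have "\<one> \<otimes> \<one> \<in> Q <#> T" unfolding set_mult_def T_def using Q.one_closed by blast
  then have one: "\<one> \<in> Q <#> T" by simp
  have "H \<subseteq> Q"
  proof
    fix h assume h: "h \<in> H"
    then have "\<one> \<otimes> h \<in> Q <#> T" using absorb one S(3) H.mem_carrier by blast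
    then obtain q t where qt: "q \<in> Q" "t \<in> T" "h = q \<otimes> t"
      using h H.mem_carrier by (auto simp: set_mult_def)
    have "t = inv q \<otimes> h" using qt T by (auto simp: m_assoc[symmetric] Q.mem_carrier)
    then have "t \<in> H" using h qt(1) QH by (auto intro!: H.m_closed H.m_inv_closed)
    then have "t \<in> Q" unfolding Q_def using qt(2) by (auto simp: Y_def intro: generate.incl)
    then show "h \<in> Q" using qt by simp
  qed
  then have "H = generate G Y" using QH unfolding Q_def by simp
  then show ?thesis using Y H.subset unfolding finitely_generated_def by blast
qed

text \<open>Adjoining \<open>a\<close> to the generators multiplies the group by the finite subgroup
  \<open>{a\<^sup>i | i < m}\<close>.\<close>

lemma (in comm_group) finite_generate_finite_exponent:
  fixes m :: nat
  assumes "finite S" "S \<subseteq> carrier G" "m > 0" "\<And>x. x \<in> carrier G \<Longrightarrow> x [^] m = \<one>"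
  shows "finite (generate G S)"
  using assms(1,2)
proof induction
  case empty
  then show ?case by (simp add: generate_empty)
next
  case (insert a S)
  let ?A = "(\<lambda>i::nat. a [^] i) ` {..<m}"
  have a: "a \<in> carrier G" and S: "S \<subseteq> carrier G" using insert.prems by auto
  have red: "a [^] i \<in> ?A" for i :: nat
  proof -
    have "a [^] i = a [^] (m * (i div m) + i mod m)" by simp
    also have "\<dots> = (a [^] m) [^] (i div m) \<otimes> a [^] (i mod m)"
      using a nat_pow_mult nat_pow_pow by metis
    also have "\<dots> = a [^] (i mod m)" using a assms(4) by simp
    finally show ?thesis using assms(3) by auto
  qed
  have "subgroup ?A G"
  proof (rule subgroup.intro)
    fix x y assume "x \<in> ?A" "y \<in> ?A"
    then show "x \<otimes> y \<in> ?A" using red a by (auto simp: nat_pow_mult)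
  next
    show "\<one> \<in> ?A" using red[of 0] by simp
  next
    fix x assume "x \<in> ?A"
    then obtain i where i: "i < m" "x = a [^] i" by auto
    have "a [^] (m - i) \<otimes> x = \<one>" using i a assms(4) by (simp add: nat_pow_mult)
    then have "inv x = a [^] (m - i)" using a i by (metis inv_equality nat_pow_closed)
    then show "inv x \<in> ?A" using red by simp
  qed (use a in auto)
  then have sub: "subgroup (?A <#> generate G S) G"
    by (intro mult_subgroups generate_is_subgroup S)
  have "a \<otimes> \<one> \<in> ?A <#> generate G S"
    using red[of 1] a generate.one[of G S] unfolding set_mult_def by force
  moreover have "s \<in> ?A <#> generate G S" if "s \<in> S" for s
  proof -
    have "\<one> \<otimes> s \<in> ?A <#> generate G S"
      using red[of 0] generate.incl[OF that, of G] unfolding set_mult_def by force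
    then show ?thesis using that S by auto
  qed
  ultimately have "generate G (insert a S) \<subseteq> ?A <#> generate G S"
    using a by (intro generate_subgroup_incl[OF _ sub]) auto
  moreover have "finite (?A <#> generate G S)"
    using insert.IH[OF S] by (auto simp: set_mult_def)
  ultimately show ?case by (rule finite_subset)
qed

lemma finitely_generated_free_group:
  assumes "finite X"
  shows "finitely_generated (carrier (free_group X)) (free_group X)"
proof -
  let ?G = "free_group X"
  let ?S = "(\<lambda>x. [(x, True)]) ` X"
  interpret group ?G by (rule group_free_group)
  have S: "?S \<subseteq> carrier ?G" by (auto simp: free_group_def)
  have "w \<in> generate ?G ?S" if "w \<in> carrier ?G" for w
    using that
  proof (induction w)
    case Nil
    then show ?case using generate.one[of ?G ?S] by (simp add: free_group_def)
  next
    case (Cons a w)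
    obtain x s where a: "a = (x, s)" by force
    have x: "x \<in> X" and w: "w \<in> carrier ?G"
      using Cons.prems a by (auto simp: free_group_def dest: reduced_ConsD)
    have "[(x, False)] \<otimes>\<^bsub>?G\<^esub> [(x, True)] = \<one>\<^bsub>?G\<^esub>"
      by (simp add: free_group_def inv_letter_def)
    then have "inv\<^bsub>?G\<^esub> [(x, True)] = [(x, False)]"
      using x by (intro inv_equality) (auto simp: free_group_def)
    moreover have "[(x, True)] \<in> ?S" using x by simp
    ultimately have "[a] \<in> generate ?G ?S"
      using generate.incl[of "[(x, True)]" ?S ?G] generate.inv[of "[(x, True)]" ?S ?G] a
      by (cases s) auto
    moreover have "a # w = [a] \<otimes>\<^bsub>?G\<^esub> w"
      using Cons.prems by (simp add: free_group_def cons_red_reduced)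
    ultimately show ?case using generate.eng Cons.IH[OF w] by metis
  qed
  then have "carrier ?G = generate ?G ?S" using generate_incl[OF S] by blast
  then show ?thesis using assms S unfolding finitely_generated_def by blast
qed

section \<open>Commutators and powers as a verbal subgroup\<close>

text \<open>The verbal subgroup of \<open>A\<close> for the laws \<open>[x, y] = 1\<close> and \<open>x\<^sup>m = 1\<close> that define \<open>Ab(m)\<close>.\<close>

definition ab_verbal :: "('a, 'b) monoid_scheme \<Rightarrow> nat \<Rightarrow> 'a set \<Rightarrow> 'a set" where
  "ab_verbal G m A = derived G A <#>\<^bsub>G\<^esub> pow_subgroup G m A"

context group
begin

lemma pow_subgroup_is_subgroup:
  "A \<subseteq> carrier G \<Longrightarrow> subgroup (pow_subgroup G m A) G"
  unfolding pow_subgroup_def by (intro generate_is_subgroup) auto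

lemma pow_subgroup_normal:
  assumes "N \<lhd> G"
  shows "pow_subgroup G m N \<lhd> G"
proof -
  interpret N: normal N G by fact
  have conj_pow: "g \<otimes> u [^] k \<otimes> inv g = (g \<otimes> u \<otimes> inv g) [^] k"
    if "g \<in> carrier G" "u \<in> carrier G" for g u and k :: nat
  proof (induction k)
    case (Suc k)
    have "g \<otimes> u [^] Suc k \<otimes> inv g = (g \<otimes> u [^] k \<otimes> inv g) \<otimes> (g \<otimes> u \<otimes> inv g)"
      using that by (simp add: m_assoc inv_solve_left)
    then show ?case using Suc.IH by simp
  qed (use that in simp)
  show ?thesis
    unfolding pow_subgroup_def
  proof (rule normal_generateI)
    fix h g assume "h \<in> {u [^] m |u. u \<in> N}" and g: "g \<in> carrier G"
    then obtain u where "u \<in> N" "h = u [^] m" by blast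
    then show "g \<otimes> h \<otimes> inv g \<in> {u [^] m |u. u \<in> N}"
      using conj_pow[OF g N.mem_carrier] N.inv_op_closed2[OF g] by auto
  qed auto
qed

lemma ab_verbal_normal: "N \<lhd> G \<Longrightarrow> ab_verbal G m N \<lhd> G"
  unfolding ab_verbal_def
  by (intro normal_subgroup_set_mult_closed derived_is_normal pow_subgroup_normal)

text \<open>The universal property: questions about inclusions of verbal subgroups become questions about
  single commutators and powers.\<close>

lemma ab_verbal_subset_iff:
  assumes "A \<subseteq> carrier G" "subgroup M G"
  shows "ab_verbal G m A \<subseteq> M \<longleftrightarrow> derived_set G A \<subseteq> M \<and> (\<forall>x\<in>A. x [^] m \<in> M)"
proof -
  let ?D = "derived G A" and ?P = "pow_subgroup G m A"
  interpret M: subgroup M G by fact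
  interpret D: subgroup ?D G by (rule derived_is_subgroup[OF assms(1)])
  interpret P: subgroup ?P G by (rule pow_subgroup_is_subgroup[OF assms(1)])
  have "ab_verbal G m A \<subseteq> M \<longleftrightarrow> ?D \<subseteq> M \<and> ?P \<subseteq> M"
  proof (intro iffI conjI subsetI)
    fix x assume V: "ab_verbal G m A \<subseteq> M"
    { assume x: "x \<in> ?D"
      have "x \<otimes> \<one> \<in> ab_verbal G m A"
        unfolding ab_verbal_def set_mult_def using x P.one_closed by blast
      then show "x \<in> M" using V x D.mem_carrier by auto }
    { assume x: "x \<in> ?P"
      have "\<one> \<otimes> x \<in> ab_verbal G m A"
        unfolding ab_verbal_def set_mult_def using x D.one_closed by blast
      then show "x \<in> M" using V x P.mem_carrier by auto }
  next
    fix x assume "?D \<subseteq> M \<and> ?P \<subseteq> M" "x \<in> ab_verbal G m A"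
    then show "x \<in> M" by (auto simp: ab_verbal_def set_mult_def)
  qed
  moreover have "generate G S \<subseteq> M \<longleftrightarrow> S \<subseteq> M" for S
    using generate_subgroup_incl[OF _ assms(2)] generate.incl[of _ S G] by blast
  ultimately have "ab_verbal G m A \<subseteq> M \<longleftrightarrow>
      derived_set G A \<subseteq> M \<and> {x [^] m |x. x \<in> A} \<subseteq> M"
    by (simp only: derived_def pow_subgroup_def)
  then show ?thesis by blast
qed

lemma ab_verbal_mono:
  assumes "A \<subseteq> B"
  shows "ab_verbal G m A \<subseteq> ab_verbal G m B"
  unfolding ab_verbal_def pow_subgroup_def
  using assms by (intro mono_set_mult mono_derived mono_generate) auto

lemma ab_verbal_incl:
  assumes "subgroup H G"
  shows "ab_verbal G m H \<subseteq> H"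
proof -
  interpret H: subgroup H G by fact
  have "x [^] m \<in> H" if "x \<in> H" for x
    using that by (induction m) auto
  then show ?thesis
    using derived_set_incl[OF order_refl assms] by (simp add: ab_verbal_subset_iff H.subset assms)
qed

text \<open>The commutators and powers are the same computed in \<open>H\<close> or in \<open>G\<close>; this is what allows
  statements about whole groups to be applied to subgroups.\<close>

lemma ab_verbal_consistent:
  assumes "subgroup H G"
  shows "ab_verbal (G\<lparr>carrier := H\<rparr>) m H = ab_verbal G m H"
proof -
  have "{u [^]\<^bsub>G\<lparr>carrier := H\<rparr>\<^esub> m |u. u \<in> H} = {u [^] m |u. u \<in> H}"
    using nat_pow_consistent[where H = H] by simp
  moreover have "{u [^] m |u. u \<in> H} \<subseteq> H"
    using ab_verbal_incl[OF assms] assms by (auto simp: ab_verbal_subset_iff subgroup.subset)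
  ultimately have "pow_subgroup (G\<lparr>carrier := H\<rparr>) m H = pow_subgroup G m H"
    unfolding pow_subgroup_def using generate_consistent[OF _ assms] by simp
  then show ?thesis
    unfolding ab_verbal_def using derived_consistent[OF order_refl assms] by simp
qed

lemma ab_verbal_trivial_iff:
  "ab_verbal G m (carrier G) \<subseteq> {\<one>} \<longleftrightarrow> comm_group G \<and> (\<forall>x\<in>carrier G. x [^] m = \<one>)"
proof -
  have eq: "x \<otimes> y \<otimes> inv x \<otimes> inv y = \<one> \<longleftrightarrow> x \<otimes> y = y \<otimes> x"
    if "x \<in> carrier G" "y \<in> carrier G" for x y
  proof -
    have "x \<otimes> y \<otimes> inv x \<otimes> inv y = (x \<otimes> y) \<otimes> inv (y \<otimes> x)"
      using that by (simp add: m_assoc inv_mult_group)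
    then show ?thesis using that by (metis inv_solve_right' l_one m_closed one_closed r_inv)
  qed
  have "derived_set G (carrier G) \<subseteq> {\<one>} \<longleftrightarrow> comm_group G"
  proof
    assume "derived_set G (carrier G) \<subseteq> {\<one>}"
    then show "comm_group G" using eq by (intro group_comm_groupI) auto
  next
    assume "comm_group G"
    then show "derived_set G (carrier G) \<subseteq> {\<one>}" using eq by (auto simp: comm_groupE(4))
  qed
  then show ?thesis using triv_subgroup by (simp add: ab_verbal_subset_iff)
qed

lemma ab_verbal_trivial_subgroup_iff:
  assumes "subgroup N G"
  shows "comm_group (G\<lparr>carrier := N\<rparr>) \<and> (\<forall>x\<in>N. x [^]\<^bsub>G\<lparr>carrier := N\<rparr>\<^esub> m = \<one>)
    \<longleftrightarrow> ab_verbal G m N \<subseteq> {\<one>}"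
  using group.ab_verbal_trivial_iff[OF subgroup_imp_group[OF assms], of m]
    ab_verbal_consistent[OF assms, of m] by simp

end

lemma (in group_hom) ab_verbal_img:
  assumes "A \<subseteq> carrier G"
  shows "h ` ab_verbal G m A = ab_verbal H m (h ` A)"
proof -
  have "h ` {u [^] m |u. u \<in> A} = {u [^]\<^bsub>H\<^esub> m |u. u \<in> h ` A}"
    using assms hom_nat_pow by (auto simp: setcompr_eq_image image_image subset_iff intro!: image_cong)
  moreover have "{u [^] m |u. u \<in> A} \<subseteq> carrier G" using assms by auto
  ultimately have "h ` pow_subgroup G m A = pow_subgroup H m (h ` A)"
    using generate_img[of "{u [^] m |u. u \<in> A}"] by (simp only: pow_subgroup_def)
  then show ?thesis
    unfolding ab_verbal_def
    using set_mult_hom[OF homh G.derived_in_carrier[OF assms]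
        subgroup.subset[OF G.pow_subgroup_is_subgroup[OF assms]]]
      derived_img[OF assms] by simp
qed

lemma (in normal) group_hom_Mod: "group_hom G (G Mod H) (\<lambda>x. H #> x)"
  using factorgroup_is_group r_coset_hom_Mod is_group by (simp add: group_hom_def group_hom_axioms_def)

lemma (in normal) ab_verbal_Mod:
  "A \<subseteq> carrier G \<Longrightarrow> ab_verbal (G Mod H) m ((\<lambda>x. H #> x) ` A) = (\<lambda>x. H #> x) ` ab_verbal G m A"
  by (rule group_hom.ab_verbal_img[OF group_hom_Mod, symmetric])

lemma (in normal) image_Mod_trivial_iff:
  assumes "A \<subseteq> carrier G"
  shows "(\<lambda>x. H #> x) ` A \<subseteq> {\<one>\<^bsub>G Mod H\<^esub>} \<longleftrightarrow> A \<subseteq> H"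
proof -
  have "H #> x = H \<longleftrightarrow> x \<in> H" if "x \<in> carrier G" for x
    using that coset_join1[OF _ that subgroup_axioms] coset_join2[OF that subgroup_axioms]
    by auto
  then show ?thesis using assms by auto
qed

text \<open>The quotient map sends the verbal subgroup of \<open>G\<close> onto that of the quotient, so the latter is
  trivial exactly if the former lies in the kernel.\<close>

lemma (in normal) Ab_Mod_iff:
  "Ab m (G Mod H) \<longleftrightarrow> finite (rcosets H) \<and> ab_verbal G m (carrier G) \<subseteq> H"
proof -
  interpret Q: group "G Mod H" by (rule factorgroup_is_group)
  have "Ab m (G Mod H) \<longleftrightarrow>
      finite (rcosets H) \<and> ab_verbal (G Mod H) m (carrier (G Mod H)) \<subseteq> {\<one>\<^bsub>G Mod H\<^esub>}"
    unfolding Ab_def Q.ab_verbal_trivial_iff by (auto simp: FactGroup_def)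
  also have "ab_verbal (G Mod H) m (carrier (G Mod H)) = (\<lambda>x. H #> x) ` ab_verbal G m (carrier G)"
    unfolding carrier_FactGroup by (simp add: ab_verbal_Mod)
  also have "\<dots> \<subseteq> {\<one>\<^bsub>G Mod H\<^esub>} \<longleftrightarrow> ab_verbal G m (carrier G) \<subseteq> H"
    by (intro image_Mod_trivial_iff ab_verbal_incl subgroup_self)
  finally show ?thesis .
qed

section \<open>Groups in the product of two abelian pseudovarieties\<close>

text \<open>The subgroup \<open>ab_verbal G d (carrier G)\<close> is the smallest possible witness \<open>N\<close>, because
  \<open>G/N\<close> satisfies the laws of \<open>Ab(d)\<close> only if \<open>N\<close> contains it; and shrinking \<open>N\<close> preserves the laws
  of \<open>Ab(p)\<close>.\<close>

lemma pv_prod_Ab_iff: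
  fixes G :: "'a monoid" (structure)
  assumes "group G"
  shows "pv_prod (Ab p) (Ab d) G \<longleftrightarrow>
    finite (carrier G) \<and> ab_verbal G p (ab_verbal G d (carrier G)) \<subseteq> {\<one>}"
proof -
  interpret group G by fact
  let ?V = "ab_verbal G d (carrier G)"
  have V: "?V \<lhd> G" by (intro ab_verbal_normal normal_self)
  have Ab_N: "Ab p (G\<lparr>carrier := N\<rparr>) \<longleftrightarrow> finite N \<and> ab_verbal G p N \<subseteq> {\<one>}" if "N \<lhd> G" for N
    using ab_verbal_trivial_subgroup_iff[OF normal_imp_subgroup[OF that], of p] by (auto simp: Ab_def)
  have fin: "finite N" "finite (rcosets N)" if "finite (carrier G)" "N \<lhd> G" for N
    using that subgroup.subset[OF normal_imp_subgroup[OF that(2)]]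
    by (auto simp: RCOSETS_def intro: finite_subset)
  show ?thesis
  proof
    assume "pv_prod (Ab p) (Ab d) G"
    then obtain N where N: "finite (carrier G)" "N \<lhd> G" "ab_verbal G p N \<subseteq> {\<one>}" "?V \<subseteq> N"
      using Ab_N normal.Ab_Mod_iff unfolding pv_prod_def by blast
    then show "finite (carrier G) \<and> ab_verbal G p ?V \<subseteq> {\<one>}"
      using ab_verbal_mono[OF N(4), of p] by blast
  next
    assume "finite (carrier G) \<and> ab_verbal G p ?V \<subseteq> {\<one>}"
    then show "pv_prod (Ab p) (Ab d) G"
      unfolding pv_prod_def using V fin Ab_N normal.Ab_Mod_iff[OF V] assms by blast
  qed
qed

lemma (in normal) pv_prod_Ab_Mod_iff:
  "pv_prod (Ab p) (Ab d) (G Mod H) \<longleftrightarrow>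
    finite (rcosets H) \<and> ab_verbal G p (ab_verbal G d (carrier G)) \<subseteq> H"
proof -
  let ?V = "ab_verbal G d (carrier G)"
  have V: "?V \<subseteq> carrier G" by (intro ab_verbal_incl subgroup_self)
  have W: "ab_verbal G p ?V \<subseteq> carrier G"
    by (intro subgroup.subset normal_imp_subgroup ab_verbal_normal normal_self)
  have "ab_verbal (G Mod H) p (ab_verbal (G Mod H) d (carrier (G Mod H)))
      = (\<lambda>x. H #> x) ` ab_verbal G p ?V"
    unfolding carrier_FactGroup by (simp add: ab_verbal_Mod V)
  then show ?thesis
    using pv_prod_Ab_iff[OF factorgroup_is_group] image_Mod_trivial_iff[OF W]
    by (simp add: FactGroup_def)
qed

section \<open>Finite index\<close>

text \<open>This is finiteness of \<open>K / ab_verbal G m K\<close>, a finitely generated abelian group of exponent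
  dividing \<open>m\<close>. The quotient is taken as a subgroup of \<open>G / ab_verbal G m K\<close>, so that all cosets are
  cosets in \<open>G\<close> and the indices of \<open>ab_verbal G m K\<close> in \<open>K\<close> and of \<open>K\<close> in \<open>G\<close> can be combined.\<close>

lemma (in group) finite_cosets_ab_verbal:
  assumes "K \<lhd> G" "finitely_generated K G" "m > 0"
  shows "finite ((\<lambda>x. ab_verbal G m K #> x) ` K)"
proof -
  let ?V = "ab_verbal G m K"
  let ?Q = "G Mod ?V"
  let ?f = "\<lambda>x. ?V #> x"
  let ?N = "?f ` K"
  interpret K: normal K G by fact
  interpret V: normal ?V G by (intro ab_verbal_normal assms)
  interpret group_hom G ?Q ?f by (rule V.group_hom_Mod)
  obtain S where S: "finite S" "S \<subseteq> carrier G" "K = generate G S"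
    using assms(2) unfolding finitely_generated_def by blast
  have N: "subgroup ?N ?Q" by (rule subgroup_img_is_subgroup[OF K.subgroup_axioms])
  have "ab_verbal ?Q m ?N \<subseteq> {\<one>\<^bsub>?Q\<^esub>}"
    using V.ab_verbal_Mod[OF K.subset, of m] V.image_Mod_trivial_iff[OF V.subset] by simp
  then have ab: "comm_group (?Q\<lparr>carrier := ?N\<rparr>)"
      "\<And>x. x \<in> ?N \<Longrightarrow> x [^]\<^bsub>?Q\<lparr>carrier := ?N\<rparr>\<^esub> m = \<one>\<^bsub>?Q\<^esub>"
    using H.ab_verbal_trivial_subgroup_iff[OF N, of m] by blast+
  have SN: "?f ` S \<subseteq> ?N" using S(3) generate.incl by fastforce
  have "?N = generate ?Q (?f ` S)" using generate_img[OF S(2)] by (simp only: S(3)[symmetric])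
  also have "\<dots> = generate (?Q\<lparr>carrier := ?N\<rparr>) (?f ` S)"
    by (rule H.generate_consistent[OF SN N, symmetric])
  finally show ?thesis
    using comm_group.finite_generate_finite_exponent[OF ab(1), of "?f ` S" m] S(1) SN assms(3) ab(2)
    by simp
qed

text \<open>If \<open>t\<close> represents the coset \<open>K g\<close> and \<open>g = k t\<close>, then \<open>L g = (L k) t\<close>; only finitely many
  pairs of a coset \<open>L k\<close> and a representative \<open>t\<close> exist.\<close>

lemma (in group) finite_rcosets_tower:
  assumes "L \<subseteq> K" "subgroup K G" "subgroup L G"
    and "finite (rcosets K)" "finite ((\<lambda>x. L #> x) ` K)"
  shows "finite (rcosets L)"
proof -
  define t where "t C = (SOME x. x \<in> C)" for C :: "'a set"
  interpret K: subgroup K G by fact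
  interpret L: subgroup L G by fact
  have "L #> g \<in> (\<lambda>(A, C). A #> t C) ` ((\<lambda>x. L #> x) ` K \<times> rcosets K)" if g: "g \<in> carrier G" for g
  proof -
    have C: "K #> g \<in> rcosets K" using g K.subset by (rule rcosetsI[rotated])
    have t: "t (K #> g) \<in> K #> g"
      using K.rcosets_non_empty[OF C] some_in_eq unfolding t_def by blast
    then have tc: "t (K #> g) \<in> carrier G" using K.elemrcos_carrier[OF is_group g] by blast
    have "K #> g = K #> t (K #> g)" by (rule repr_independence[OF t g assms(2)])
    then have "g \<in> K #> t (K #> g)" using rcos_self[OF g assms(2)] by simp
    then obtain k where k: "k \<in> K" "g = k \<otimes> t (K #> g)" by (auto simp: r_coset_def)
    have "L #> g = (L #> k) #> t (K #> g)"
      using k tc by (metis K.mem_carrier L.subset coset_mult_assoc)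
    then show ?thesis using k(1) C by force
  qed
  then have "rcosets L \<subseteq> (\<lambda>(A, C). A #> t C) ` ((\<lambda>x. L #> x) ` K \<times> rcosets K)"
    by (auto simp: RCOSETS_def)
  then show ?thesis using assms(4,5) by (auto intro: finite_subset)
qed

text \<open>Schreier's lemma links the two layers: it makes the first verbal subgroup finitely generated,
  which finiteness of the second layer requires.\<close>

lemma (in group) finite_rcosets_ab_verbal_ab_verbal:
  assumes "finitely_generated (carrier G) G" "m > 0" "k > 0"
  shows "finite (rcosets (ab_verbal G k (ab_verbal G m (carrier G))))"
proof -
  let ?K = "ab_verbal G m (carrier G)"
  have K: "?K \<lhd> G" by (intro ab_verbal_normal normal_self)
  then have K': "subgroup ?K G" by (rule normal_imp_subgroup)
  have finK: "finite (rcosets ?K)"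
    using finite_cosets_ab_verbal[OF normal_self assms(1,2)]
    by (simp add: FactGroup_def flip: carrier_FactGroup)
  then have "finitely_generated ?K G"
    by (rule finitely_generated_finite_index[OF is_group assms(1) K'])
  then have "finite ((\<lambda>x. ab_verbal G k ?K #> x) ` ?K)"
    by (rule finite_cosets_ab_verbal[OF K _ assms(3)])
  with finK show ?thesis
    by (rule finite_rcosets_tower[OF ab_verbal_incl[OF K'] K'
          normal_imp_subgroup[OF ab_verbal_normal[OF K]]])
qed

lemma (in group) finite_rcosets_set_mult:
  assumes "H \<subseteq> carrier G" "L \<subseteq> carrier G" "finite (rcosets L)"
  shows "finite (rcosets (H <#> L))"
proof -
  have "rcosets (H <#> L) \<subseteq> (\<lambda>A. H <#> A) ` (rcosets L)"
    using assms(1,2) by (auto simp: RCOSETS_def setmult_rcos_assoc[symmetric])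
  then show ?thesis using assms(3) by (auto intro: finite_subset)
qed

section \<open>Closure when there is a smallest open normal subgroup\<close>

text \<open>Every basic open set is a coset of some \<open>M \<supseteq> L\<close>, so open sets are unions of cosets of \<open>L\<close>, and
  these cosets are themselves open. Hence \<open>x L\<close> is the smallest neighbourhood of \<open>x\<close>, and \<open>x\<close> is in
  the closure of \<open>H\<close> exactly if \<open>x L\<close> meets \<open>H\<close>.\<close>

lemma closure_of_pro_topology:
  fixes G (structure)
  assumes "group G" "L \<lhd> G" "V (G Mod L)"
    and least: "\<And>M. M \<lhd> G \<Longrightarrow> V (G Mod M) \<Longrightarrow> L \<subseteq> M"
    and H: "H \<subseteq> carrier G"
  shows "pro_topology G V closure_of H = H <#> L"
proof -
  interpret group G by fact
  interpret L: normal L G by fact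
  let ?B = "{x <# K | x K. x \<in> carrier G \<and> K \<lhd> G \<and> V (G Mod K)}"
  have self: "x \<in> x <# L" if "x \<in> carrier G" for x
    using that L.one_closed by (force simp: l_coset_def)
  have sat: "x <# L \<subseteq> U" if "openin (pro_topology G V) U" "x \<in> U" for x U
    using that unfolding pro_topology_def openin_topology_generated_by_iff
  proof (induction arbitrary: x)
    case (Basis s)
    then obtain y M where M: "s = y <# M" "y \<in> carrier G" "M \<lhd> G" "V (G Mod M)" by blast
    then have "x <# M = s"
      using l_repr_independence[of x y M] Basis.prems normal_imp_subgroup by blast
    then show ?case using least[OF M(3,4)] by (auto simp: l_coset_def)
  qed blast+
  have coset_open: "openin (pro_topology G V) (x <# L)" if "x \<in> carrier G" for x
    unfolding pro_topology_def using assms(2,3) that by (intro topology_generated_by_Basis) blast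
  have "\<Union>?B = carrier G"
    using assms(2,3) self l_coset_subset_G[OF subgroup.subset[OF normal_imp_subgroup]] by blast
  then have top: "topspace (pro_topology G V) = carrier G"
    by (simp add: pro_topology_def)
  show ?thesis
  proof (intro equalityI subsetI)
    fix x assume "x \<in> pro_topology G V closure_of H"
    then have x: "x \<in> carrier G"
      and meet: "\<And>U. x \<in> U \<Longrightarrow> openin (pro_topology G V) U \<Longrightarrow> \<exists>y\<in>H. y \<in> U"
      by (auto simp: in_closure_of top)
    obtain y where y: "y \<in> H" "y \<in> x <# L" using meet[OF self[OF x] coset_open[OF x]] by blast
    then have "x \<in> y <# L" using l_coset_swap[OF y(2) x L.subgroup_axioms] by blast
    then show "x \<in> H <#> L" using y(1) by (auto simp: l_coset_def set_mult_def)
  next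
    fix x assume "x \<in> H <#> L"
    then obtain y l where yl: "y \<in> H" "l \<in> L" "x = y \<otimes> l" by (auto simp: set_mult_def)
    then have x: "x \<in> carrier G" using H by auto
    have "x \<in> y <# L" using yl by (auto simp: l_coset_def)
    then have "y \<in> x <# L" using l_coset_swap[of x y L] yl(1) H L.subgroup_axioms by blast
    then show "x \<in> pro_topology G V closure_of H"
      using sat yl(1) x unfolding in_closure_of top by blast
  qed
qed

section \<open>The closure in the free group\<close>

theorem proposition3p2:
  fixes p d n :: nat and H :: "(nat \<times> bool) list set"
  assumes "Factorial_Ring.prime p" and "p > 2"
    and "d > 1" and "d dvd p - 1"
    and "n \<ge> 1"
    and "subgroup H (F n)"
  shows "Cl n p d H = H <#>\<^bsub>F n\<^esub> L_sub n p d
       \<and> finite_index (Cl n p d H) (F n)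
       \<and> finitely_generated (Cl n p d H) (F n)"
proof -
  let ?L = "L_sub n p d"
  interpret group "F n" unfolding F_def by (rule group_free_group)
  interpret H: subgroup H "F n" by fact
  have L_eq: "?L = ab_verbal (F n) p (ab_verbal (F n) d (carrier (F n)))"
    by (simp add: L_sub_def K_sub_def ab_verbal_def)
  have fg: "finitely_generated (carrier (F n)) (F n)"
    unfolding F_def by (rule finitely_generated_free_group) simp
  interpret L: normal ?L "F n"
    unfolding L_eq by (intro ab_verbal_normal normal_self)
  have fin: "finite (rcosets\<^bsub>F n\<^esub> ?L)"
    unfolding L_eq using assms(2,3) by (intro finite_rcosets_ab_verbal_ab_verbal fg) auto
  have Cl: "Cl n p d H = H <#>\<^bsub>F n\<^esub> ?L"
    unfolding Cl_def
  proof (rule closure_of_pro_topology[OF is_group L.normal_axioms])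
    show "pv_prod (Ab p) (Ab d) (F n Mod ?L)"
      unfolding L.pv_prod_Ab_Mod_iff using fin by (simp add: L_eq)
    show "?L \<subseteq> M" if "M \<lhd> F n" "pv_prod (Ab p) (Ab d) (F n Mod M)" for M
      using that normal.pv_prod_Ab_Mod_iff unfolding L_eq by blast
  qed (rule H.subset)
  interpret second_isomorphism_grp ?L "F n" H
    by unfold_locales
  have sub: "subgroup (H <#>\<^bsub>F n\<^esub> ?L) (F n)"
    using normal_set_mult_subgroup commut_normal[OF assms(6) L.normal_axioms] by simp
  have fin': "finite (rcosets\<^bsub>F n\<^esub> (H <#>\<^bsub>F n\<^esub> ?L))"
    by (rule finite_rcosets_set_mult[OF H.subset L.subset fin])
  show ?thesis
    unfolding Cl finite_index_def
    using sub fin' finitely_generated_finite_index[OF is_group fg sub fin'] by blast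
qed

end
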